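(* Let $K$ be a field and $S=K[x_1,\ldots,x_n]$. For any monomial ideal $I\subset S$ with set of minimal monomial generators $G(I)$, we have $$\operatorname{slength}(I)\geq|G(I)|.$$ Moreover, $I$ is principal if and only if $\operatorname{slength}(I)=1$.
   Context: Let $M$ be a finitely generated $\mathbb Z^n$-graded $S$-module, $S=K[x_1,\ldots,x_n]$. A Stanley decomposition of $M$ is a finite direct sum of $K$-vector spaces $\mathcal D: M=\bigoplus_{i=1}^r m_iK[Z_i]$, where each $m_i\in M$ is homogeneous, $Z_i\subset\{x_1,\ldots,x_n\}$, and $m_iK[Z_i]$ is a free $K[Z_i]$-module. Its length is $\operatorname{slength}(\mathcal D)=r$, and the Stanley length of $M$ is $\operatorname{slength}(M)=\min\{\operatorname{slength}(\mathcal D):\mathcal D\text{ is a Stanley decomposition of }M\}$.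
   Formalization: The equivalence "I is principal if and only if slength(I)=1" is stated for nonzero I only: the zero ideal is principal, but the empty direct sum is a Stanley decomposition of it, so its Stanley length is 0. The inequality is stated for every monomial ideal. *)

theory Defs
  imports Complex_Main "HOL-Library.Poly_Mapping" "HOL-Library.FuncSet"
begin

(* K[x_i | i :: 'n]: an exponent vector is a finitely supported map 'n => nat, and a
   polynomial is a finitely supported map from exponent vectors to K. *)
type_synonym 'n expo = "'n \<Rightarrow>\<^sub>0 nat"
type_synonym ('n, 'k) mvpoly = "'n expo \<Rightarrow>\<^sub>0 'k"

abbreviation mono_of :: "'n expo \<Rightarrow> ('n, 'k::field) mvpoly" where
  "mono_of u \<equiv> Poly_Mapping.single u 1"

(* The ideals of S are the submodules of S as a module over itself. *)
abbreviation ideal_gen :: "('n, 'k::field) mvpoly set \<Rightarrow> ('n, 'k) mvpoly set" where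
  "ideal_gen \<equiv> module.span (*)"

definition principal_ideal :: "('n, 'k::field) mvpoly set \<Rightarrow> bool" where
  "principal_ideal I \<longleftrightarrow> (\<exists>f. I = ideal_gen {f})"

definition monomial_ideal :: "('n, 'k::field) mvpoly set \<Rightarrow> bool" where
  "monomial_ideal I \<longleftrightarrow> (\<exists>A. A \<subseteq> range mono_of \<and> I = ideal_gen A)"

definition minimal_monomial_generating_set ::
    "('n, 'k::field) mvpoly set \<Rightarrow> ('n, 'k) mvpoly set \<Rightarrow> bool" where
  "minimal_monomial_generating_set I G \<longleftrightarrow>
     G \<subseteq> range mono_of \<and> ideal_gen G = I \<and> (\<forall>H. H \<subset> G \<longrightarrow> ideal_gen H \<noteq> I)"

(* G(I); for monomial ideals the description is justified by
   ex1_minimal_monomial_generating_set below. *)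
definition minimal_generators :: "('n, 'k::field) mvpoly set \<Rightarrow> ('n, 'k) mvpoly set" where
  "minimal_generators I = (THE G. minimal_monomial_generating_set I G)"

(* The homogeneous component of degree a of S; it is 0 if a has a negative entry. *)
definition multidegree_comp :: "('n \<Rightarrow> int) \<Rightarrow> ('n, 'k::field) mvpoly set" where
  "multidegree_comp a = {f. \<forall>u\<in>Poly_Mapping.keys f. \<forall>i. int (Poly_Mapping.lookup u i) = a i}"

(* The subring K[Z]. *)
definition polys_in :: "'n set \<Rightarrow> ('n, 'k::field) mvpoly set" where
  "polys_in Z = {p. \<forall>u\<in>Poly_Mapping.keys p. Poly_Mapping.keys u \<subseteq> Z}"

(* m K[Z], for m in an S-module with scalar multiplication sc. *)
definition stanley_space ::
    "(('n, 'k::field) mvpoly \<Rightarrow> 'm \<Rightarrow> 'm) \<Rightarrow> 'm \<Rightarrow> 'n set \<Rightarrow> 'm set" where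
  "stanley_space sc m Z = (\<lambda>p. sc p m) ` polys_in Z"

(* M is a graded submodule of a Z^n-graded S-module with scalar multiplication sc and
   homogeneous components gr a.  The list D consists of the pairs (m_i, Z_i).  Freeness of
   m_i K[Z_i] means that m_i is a basis of it (so m_i is not 0); the last conjunct says that
   every element of M is a sum of elements of the m_i K[Z_i] in a unique way, and that every
   such sum lies in M. *)
definition stanley_decomposition ::
    "(('n, 'k::field) mvpoly \<Rightarrow> 'm::ab_group_add \<Rightarrow> 'm) \<Rightarrow> (('n \<Rightarrow> int) \<Rightarrow> 'm set) \<Rightarrow> 'm set
      \<Rightarrow> ('m \<times> 'n set) list \<Rightarrow> bool" where
  "stanley_decomposition sc gr M D \<longleftrightarrow>
     (\<forall>(m, Z)\<in>set D. m \<in> M \<and> (\<exists>a. m \<in> gr a) \<and> (\<forall>p\<in>polys_in Z. sc p m = 0 \<longrightarrow> p = 0)) \<and>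
     bij_betw (\<lambda>g. \<Sum>i<length D. g i)
       (\<Pi>\<^sub>E i\<in>{..<length D}. stanley_space sc (fst (D ! i)) (snd (D ! i))) M"

definition slength ::
    "(('n, 'k::field) mvpoly \<Rightarrow> 'm::ab_group_add \<Rightarrow> 'm) \<Rightarrow> (('n \<Rightarrow> int) \<Rightarrow> 'm set) \<Rightarrow> 'm set
      \<Rightarrow> nat" where
  "slength sc gr M = (LEAST r. \<exists>D. stanley_decomposition sc gr M D \<and> length D = r)"

(* An ideal of S, graded by its intersections with the components of S. *)
abbreviation ideal_slength :: "('n, 'k::field) mvpoly set \<Rightarrow> nat" where
  "ideal_slength I \<equiv> slength (*) multidegree_comp I"


lemma module_times: "module ((*) :: ('n, 'k::field) mvpoly \<Rightarrow> _ \<Rightarrow> _)"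
  by unfold_locales (simp_all add: algebra_simps)

lemma mono_mem_ideal_gen:
  "(mono_of v :: ('n, 'k::field) mvpoly) \<in> ideal_gen (mono_of ` A) \<longleftrightarrow> (\<exists>u\<in>A. \<exists>w. v = u + w)"
proof -
  interpret module "(*) :: ('n, 'k) mvpoly \<Rightarrow> _ \<Rightarrow> _" by (rule module_times)
  let ?T = "{f :: ('n, 'k) mvpoly. \<forall>k\<in>Poly_Mapping.keys f. \<exists>u\<in>A. \<exists>w. k = u + w}"
  have "subspace ?T"
  proof (rule subspaceI)
    fix x y :: "('n, 'k) mvpoly"
    assume "x \<in> ?T" "y \<in> ?T"
    then show "x + y \<in> ?T" using Poly_Mapping.keys_add[of x y] by blast
  next
    fix c x :: "('n, 'k) mvpoly"
    assume x: "x \<in> ?T"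
    have "\<exists>u\<in>A. \<exists>w. k = u + w" if k: "k \<in> Poly_Mapping.keys (c * x)" for k
    proof -
      obtain a b where "k = a + b" "b \<in> Poly_Mapping.keys x"
        using k Poly_Mapping.keys_mult[of c x] by blast
      moreover from this obtain u w where "u \<in> A" "b = u + w" using x by blast
      ultimately have "u \<in> A" "k = a + (u + w)" by simp_all
      then show ?thesis by (metis add.left_commute)
    qed
    then show "c * x \<in> ?T" by blast
  qed simp
  moreover have "mono_of ` A \<subseteq> ?T"
    by clarsimp (metis add.right_neutral)
  ultimately have sub: "span (mono_of ` A) \<subseteq> ?T" by (rule span_minimal[rotated])
  show ?thesis
  proof
    assume "(mono_of v :: ('n, 'k) mvpoly) \<in> ideal_gen (mono_of ` A)"
    then have "mono_of v \<in> ?T" using sub by blast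
    then show "\<exists>u\<in>A. \<exists>w. v = u + w" by simp
  next
    assume "\<exists>u\<in>A. \<exists>w. v = u + w"
    then obtain u w where "u \<in> A" "v = w + u" by (metis add.commute)
    then have "mono_of v = mono_of w * (mono_of u :: ('n, 'k) mvpoly)"
      by (simp add: Poly_Mapping.mult_single)
    then show "(mono_of v :: ('n, 'k) mvpoly) \<in> ideal_gen (mono_of ` A)"
      using \<open>u \<in> A\<close> by (simp add: span_scale span_base)
  qed
qed

lemma ex1_minimal_monomial_generating_set:
  fixes I :: "('n::finite, 'k::field) mvpoly set"
  assumes "monomial_ideal I"
  shows "\<exists>!G. minimal_monomial_generating_set I G"
proof -
  interpret module "(*) :: ('n, 'k) mvpoly \<Rightarrow> _ \<Rightarrow> _" by (rule module_times)
  let ?m = "mono_of :: 'n expo \<Rightarrow> ('n, 'k) mvpoly"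
  let ?d = "\<lambda>u :: 'n expo. \<Sum>i\<in>UNIV. Poly_Mapping.lookup u i"
  have d_add: "?d (u + w) = ?d u + ?d w" for u w
    by (simp add: lookup_add sum.distrib)
  have d_0: "w = 0" if "?d w = 0" for w
    using that by (intro poly_mapping_eqI) simp
  define E where "E = {v. ?m v \<in> I}"
  define B where "B = {v \<in> E. \<forall>u\<in>E. \<forall>w. v = u + w \<longrightarrow> w = 0}"
  have below: "\<exists>u\<in>B. \<exists>w. v = u + w" if "v \<in> E" for v
    using that
  proof (induction "?d v" arbitrary: v rule: less_induct)
    case less
    show ?case
    proof (cases "v \<in> B")
      case True
      then show ?thesis by (metis add.right_neutral)
    next
      case False
      then obtain u w where uw: "u \<in> E" "v = u + w" "w \<noteq> 0" using less.prems B_def by blast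
      have "?d w \<noteq> 0" using d_0[of w] uw(3) by blast
      then have "?d u < ?d v" unfolding uw(2) d_add by linarith
      then obtain u' w' where "u' \<in> B" "u = u' + w'" using less.hyps uw(1) by blast
      then show ?thesis using uw(2) by (metis add.assoc)
    qed
  qed
  have gen: "span (?m ` A) = I \<longleftrightarrow> B \<subseteq> A \<and> A \<subseteq> E" for A
  proof
    assume eq: "span (?m ` A) = I"
    then have AE: "A \<subseteq> E" using span_base[of _ "?m ` A"] E_def by blast
    have "v \<in> A" if v: "v \<in> B" for v
    proof -
      have "?m v \<in> span (?m ` A)" using v eq B_def E_def by blast
      then obtain u w where "u \<in> A" "v = u + w" using mono_mem_ideal_gen by blast
      then show ?thesis using v AE B_def by force
    qed
    then show "B \<subseteq> A \<and> A \<subseteq> E" using AE by blast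
  next
    assume A: "B \<subseteq> A \<and> A \<subseteq> E"
    obtain C where C: "C \<subseteq> range ?m" "I = span C"
      using assms unfolding monomial_ideal_def by blast
    have "subspace I" using C by simp
    moreover have "?m ` A \<subseteq> I" using A E_def by blast
    ultimately have 1: "span (?m ` A) \<subseteq> I" by (simp add: span_minimal)
    have "C \<subseteq> span (?m ` A)"
    proof
      fix c assume c: "c \<in> C"
      then obtain v where v: "c = ?m v" using C by blast
      have "v \<in> E" using c v C span_base[of c C] by (simp add: E_def)
      then show "c \<in> span (?m ` A)" using below[of v] A v mono_mem_ideal_gen by blast
    qed
    then have "I \<subseteq> span (?m ` A)" using C by (simp add: span_minimal)
    with 1 show "span (?m ` A) = I" by blast
  qed
  have BE: "B \<subseteq> E" unfolding B_def by blast
  have inj: "inj ?m"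
  proof (rule injI)
    fix u v assume "?m u = ?m v"
    then have "Poly_Mapping.keys (?m u) = Poly_Mapping.keys (?m v)" by (rule arg_cong)
    then show "u = v" by simp
  qed
  show ?thesis
  proof (rule ex1I)
    show "minimal_monomial_generating_set I (?m ` B)"
      unfolding minimal_monomial_generating_set_def
    proof (intro conjI allI impI notI)
      show "span (?m ` B) = I" using gen BE by blast
      fix H assume H: "H \<subset> ?m ` B" "span H = I"
      then obtain A where A: "H = ?m ` A" by (meson psubset_imp_subset subset_image_iff)
      then have "B \<subseteq> A" using gen H by blast
      then show False using H A by blast
    qed blast
  next
    fix G assume G: "minimal_monomial_generating_set I G"
    then obtain A where A: "G = ?m ` A"
      unfolding minimal_monomial_generating_set_def by (meson subset_imageE)
    then have "B \<subseteq> A" using G gen unfolding minimal_monomial_generating_set_def by blast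
    moreover have "\<not> ?m ` B \<subset> G" using G gen BE unfolding minimal_monomial_generating_set_def by blast
    ultimately show "G = ?m ` B" using A by blast
  qed
qed

end

theory Submission
  imports Defs "HOL-Library.Disjoint_Sets"
begin

text \<open>
  Let \<open>E\<close> be the set of exponents of the monomials in \<open>I\<close>. A nonzero homogeneous element of \<open>S\<close>
  is a scalar multiple of a monomial, so its Stanley space consists of the polynomials supported
  on a cone \<open>u + \<nat>\<^sup>Z\<close> with \<open>u \<in> E\<close>. A minimal generator lies in one of the cones of a Stanley
  decomposition and, being minimal, is the apex of that cone; hence there are at least
  \<open>|G(I)|\<close> cones. If \<open>I = (f)\<close> then every minimal exponent \<open>v\<close> occurs in \<open>f\<close>, and its coefficient in
  \<open>f * h\<close> is \<open>f\<^sub>v * h\<^sub>0\<close>. If \<open>f * h\<close> is the monomial of one minimal exponent then \<open>h\<^sub>0 \<noteq> 0\<close>, so every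
  minimal exponent occurs in \<open>f * h\<close>; hence there is only one and \<open>E\<close> is a single cone. Stanley
  decompositions exist because every up-set of \<open>\<nat>\<^sup>n\<close> is a finite disjoint union of cones.
\<close>

section \<open>Up-sets as disjoint unions of cones\<close>

text \<open>These are the exponents of the monomials in the Stanley space with apex exponent
  \<open>fst p\<close> and variables \<open>snd p\<close>. Apex and directions form one pair so that
  a family of cones is a plain set of pairs.\<close>

definition cone :: "('a \<Rightarrow>\<^sub>0 nat) \<times> 'a set \<Rightarrow> ('a \<Rightarrow>\<^sub>0 nat) set" where
  "cone p = {fst p + w | w. Poly_Mapping.keys w \<subseteq> snd p}"

lemma apex_in_cone: "u \<in> cone (u, Z)"
  unfolding cone_def by (auto intro: exI[of _ 0])

lemma cone_shift: "cone (u + a, Z) = (\<lambda>v. v + a) ` cone (u, Z)"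
proof -
  have "cone (u + a, Z) = (\<lambda>w. u + a + w) ` {w. Poly_Mapping.keys w \<subseteq> Z}"
    unfolding cone_def by auto
  also have "\<dots> = (\<lambda>v. v + a) ` (\<lambda>w. u + w) ` {w. Poly_Mapping.keys w \<subseteq> Z}"
    by (simp add: image_image ac_simps)
  also have "(\<lambda>w. u + w) ` {w. Poly_Mapping.keys w \<subseteq> Z} = cone (u, Z)"
    unfolding cone_def by auto
  finally show ?thesis .
qed

text \<open>Natural numbers admit no cancellation, so the usual inclusion for the support of a sum
  is an equality.\<close>

lemma keys_add_nat:
  fixes u v :: "'a \<Rightarrow>\<^sub>0 nat"
  shows "Poly_Mapping.keys (u + v) = Poly_Mapping.keys u \<union> Poly_Mapping.keys v"
  by (auto simp: in_keys_iff lookup_add)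

text \<open>A cone is stacked in direction \<open>x\<close>: the new direction supplies every height
  from \<open>k\<close> on. This lets finitely many cones cover infinitely many slices of an
  up-set.\<close>

lemma cone_insert:
  "cone (u + Poly_Mapping.single x k, insert x Z) =
    (\<Union>l\<in>{k..}. (\<lambda>v. v + Poly_Mapping.single x l) ` cone (u, Z))" (is "?L = ?R")
proof
  show "?R \<subseteq> ?L"
  proof
    fix v assume "v \<in> ?R"
    then obtain l w where l: "k \<le> l" "Poly_Mapping.keys w \<subseteq> Z" "v = u + w + Poly_Mapping.single x l"
      unfolding cone_def by auto
    have "Poly_Mapping.single x l = Poly_Mapping.single x k + Poly_Mapping.single x (l - k)"
      using l(1) by (simp flip: single_add)
    then have "v = u + Poly_Mapping.single x k + (w + Poly_Mapping.single x (l - k))"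
      using l(3) by (simp add: ac_simps)
    moreover have "Poly_Mapping.keys (w + Poly_Mapping.single x (l - k)) \<subseteq> insert x Z"
      using l(2) by (auto simp: keys_add_nat split: if_splits)
    ultimately show "v \<in> ?L" unfolding cone_def by auto
  qed
  show "?L \<subseteq> ?R"
  proof
    fix v assume "v \<in> ?L"
    then obtain w where w: "Poly_Mapping.keys w \<subseteq> insert x Z" "v = u + Poly_Mapping.single x k + w"
      unfolding cone_def by auto
    let ?j = "Poly_Mapping.lookup w x"
    define w' where "w' = w - Poly_Mapping.single x ?j"
    have eq: "w = w' + Poly_Mapping.single x ?j"
      by (rule poly_mapping_eqI) (simp add: w'_def lookup_add lookup_minus lookup_single when_def)
    have "Poly_Mapping.keys w' \<subseteq> Z"
      using w(1) by (auto simp: w'_def subset_iff in_keys_iff lookup_minus lookup_single when_def split: if_splits)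
    moreover have "v = u + w' + Poly_Mapping.single x (k + ?j)"
      unfolding w(2) single_add by (subst eq) (simp only: ac_simps)
    ultimately show "v \<in> ?R" unfolding cone_def by (auto intro!: bexI[of _ "k + ?j"])
  qed
qed

text \<open>Induction on the set of variables. Slicing \<open>E\<close> by the exponent of the new
  variable \<open>x\<close> gives an increasing chain of up-sets over \<open>V\<close>, which
  becomes constant at some \<open>N\<close>. Cones for the slices below \<open>N\<close> stay at
  their own height, and those for slice \<open>N\<close> are extended in direction
  \<open>x\<close>.\<close>

lemma upset_disjoint_cones:
  fixes E :: "('a \<Rightarrow>\<^sub>0 nat) set"
  assumes "finite V" and "\<forall>u\<in>E. Poly_Mapping.keys u \<subseteq> V"
    and "\<forall>u\<in>E. \<forall>w. Poly_Mapping.keys w \<subseteq> V \<longrightarrow> u + w \<in> E"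
  shows "\<exists>P. finite P \<and> disjoint_family_on cone P \<and> (\<Union>p\<in>P. cone p) = E"
  using assms
proof (induction V arbitrary: E rule: finite_induct)
  case empty
  show ?case
  proof (cases "E = {}")
    case True
    then show ?thesis by (auto simp: disjoint_family_on_def intro!: exI[of _ "{}"])
  next
    case False
    then have "E = {0}" using empty by auto
    then have "cone (0, {}) = E" unfolding cone_def by auto
    then show ?thesis by (intro exI[of _ "{(0, {})}"]) (auto simp: disjoint_family_on_def)
  qed
next
  case (insert x V)
  define sl where "sl k = {u. Poly_Mapping.keys u \<subseteq> V \<and> u + Poly_Mapping.single x k \<in> E}" for k
  have up: "\<exists>P. finite P \<and> disjoint_family_on cone P \<and> (\<Union>p\<in>P. cone p) = sl k" for k
  proof (rule insert.IH)
    show "\<forall>u\<in>sl k. \<forall>w. Poly_Mapping.keys w \<subseteq> V \<longrightarrow> u + w \<in> sl k"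
    proof (intro ballI allI impI)
      fix u w :: "'a \<Rightarrow>\<^sub>0 nat"
      assume u: "u \<in> sl k" "Poly_Mapping.keys w \<subseteq> V"
      have "(u + Poly_Mapping.single x k) + w \<in> E" using u insert.prems(2) unfolding sl_def by blast
      then show "u + w \<in> sl k" using u unfolding sl_def by (simp add: keys_add_nat ac_simps)
    qed
  qed (simp add: sl_def)
  have mono: "sl k \<subseteq> sl l" if "k \<le> l" for k l
  proof
    fix u assume u: "u \<in> sl k"
    have "Poly_Mapping.single x l = Poly_Mapping.single x k + Poly_Mapping.single x (l - k)"
      using that by (simp flip: single_add)
    moreover have "(u + Poly_Mapping.single x k) + Poly_Mapping.single x (l - k) \<in> E"
      using u insert.prems(2) unfolding sl_def by (auto split: if_splits)
    ultimately show "u \<in> sl l" using u unfolding sl_def by (simp add: ac_simps)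
  qed
  \<comment> \<open>The slices stabilise since their union, being a finite union of cones, is already
    contained in any slice that contains all the apices.\<close>
  obtain P where P: "finite P" "(\<Union>p\<in>P. cone p) = (\<Union>k. sl k)"
  proof -
    have "\<exists>P. finite P \<and> disjoint_family_on cone P \<and> (\<Union>p\<in>P. cone p) = (\<Union>k. sl k)"
    proof (rule insert.IH)
      show "\<forall>u\<in>\<Union>k. sl k. \<forall>w. Poly_Mapping.keys w \<subseteq> V \<longrightarrow> u + w \<in> (\<Union>k. sl k)"
      proof (intro ballI allI impI)
        fix u w :: "'a \<Rightarrow>\<^sub>0 nat"
        assume "u \<in> (\<Union>k. sl k)" and w: "Poly_Mapping.keys w \<subseteq> V"
        then obtain k where u: "u \<in> sl k" by blast
        have "(u + Poly_Mapping.single x k) + w \<in> E"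
          using u w insert.prems(2) unfolding sl_def by blast
        then have "u + w \<in> sl k" using u w unfolding sl_def by (simp add: keys_add_nat ac_simps)
        then show "u + w \<in> (\<Union>k. sl k)" by blast
      qed
    qed (auto simp: sl_def)
    then show ?thesis using that by blast
  qed
  have "\<exists>k. fst p \<in> sl k" if "p \<in> P" for p
    using that P(2) apex_in_cone[of "fst p" "snd p"] by auto
  then obtain kk where kk: "\<And>p. p \<in> P \<Longrightarrow> fst p \<in> sl (kk p)" by metis
  \<comment> \<open>The added \<open>0\<close> gives \<open>Max\<close> a value when
    \<open>P\<close> is empty, in which case all slices are empty.\<close>
  define N where "N = Max (insert 0 (kk ` P))"
  have stable: "sl k \<subseteq> sl N" for k
  proof
    fix u assume "u \<in> sl k"
    then have uV: "Poly_Mapping.keys u \<subseteq> V" and "u \<in> (\<Union>p\<in>P. cone p)" using P(2) by (auto simp: sl_def)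
    then obtain p w where p: "p \<in> P" "u = fst p + w" unfolding cone_def by auto
    have "kk p \<le> N" unfolding N_def using P(1) p(1) by auto
    then have a: "fst p \<in> sl N" using kk[OF p(1)] mono by blast
    have "Poly_Mapping.keys w \<subseteq> V" using uV p(2) by (simp add: keys_add_nat)
    then have "(fst p + Poly_Mapping.single x N) + w \<in> E"
      using a insert.prems(2) unfolding sl_def by blast
    then show "u \<in> sl N" using uV p(2) unfolding sl_def by (simp add: ac_simps)
  qed
  obtain Q where Q: "\<And>k. finite (Q k)" "\<And>k. disjoint_family_on cone (Q k)"
    "\<And>k. (\<Union>p\<in>Q k. cone p) = sl k"
    using up by metis
  \<comment> \<open>\<open>T k\<close> lifts a cone of slice \<open>k\<close> to height
    \<open>k\<close> and, for \<open>k = N\<close>, also opens it in direction \<open>x\<close>;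
    \<open>lev k\<close> collects the heights that the lifted cone reaches.\<close>
  define T where "T k p = (fst p + Poly_Mapping.single x k, if k = N then insert x (snd p) else snd p)"
    for k :: nat and p :: "('a \<Rightarrow>\<^sub>0 nat) \<times> 'a set"
  define R where "R = (\<Union>k\<in>{..N}. T k ` Q k)"
  define lev where "lev k = (if k = N then {N..} else {k})" for k
  have coneT: "cone (T k p) = (\<Union>l\<in>lev k. (\<lambda>v. v + Poly_Mapping.single x l) ` cone p)" for k p
    using cone_insert[of "fst p" x N "snd p"] cone_shift[of "fst p" "Poly_Mapping.single x k" "snd p"]
    by (simp add: T_def lev_def)
  have cQ: "cone p \<subseteq> sl k" if "p \<in> Q k" for k p using that Q(3) by blast
  \<comment> \<open>Since \<open>x\<close> is not in \<open>V\<close>, the height is the exponent of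
    \<open>x\<close> in the sum.\<close>
  have decomp: "v = w \<and> k = l"
    if "v + Poly_Mapping.single x k = w + Poly_Mapping.single x l"
      "Poly_Mapping.keys v \<subseteq> V" "Poly_Mapping.keys w \<subseteq> V" for v w and k l :: nat
  proof -
    have "x \<notin> Poly_Mapping.keys v" "x \<notin> Poly_Mapping.keys w" using that insert.hyps by blast+
    moreover have "Poly_Mapping.lookup (v + Poly_Mapping.single x k) x =
        Poly_Mapping.lookup (w + Poly_Mapping.single x l) x" using that(1) by simp
    ultimately have "k = l" by (simp add: lookup_add in_keys_iff)
    then show ?thesis using that(1) by simp
  qed
  have slV: "Poly_Mapping.keys v \<subseteq> V" if "v \<in> sl k" for v k using that by (simp add: sl_def)
  have "finite R" unfolding R_def using Q(1) by blast
  moreover have "disjoint_family_on cone R"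
    unfolding disjoint_family_on_def
  proof (intro ballI impI equals0I)
    fix r s z assume rs: "r \<in> R" "s \<in> R" "r \<noteq> s" and z: "z \<in> cone r \<inter> cone s"
    obtain k p where k: "k \<le> N" "p \<in> Q k" "r = T k p" using rs(1) R_def by blast
    obtain l q where l: "l \<le> N" "q \<in> Q l" "s = T l q" using rs(2) R_def by blast
    obtain i v where v: "i \<in> lev k" "v \<in> cone p" "z = v + Poly_Mapping.single x i"
      using z k(3) coneT by auto
    obtain j w where w: "j \<in> lev l" "w \<in> cone q" "z = w + Poly_Mapping.single x j"
      using z l(3) coneT by auto
    have vw: "v = w" "i = j"
      using decomp[of v i w j] v w cQ[OF k(2)] cQ[OF l(2)] slV by blast+
    \<comment> \<open>The sets \<open>lev k\<close> with \<open>k \<le> N\<close> are pairwise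
      disjoint, so a common height determines the level.\<close>
    then have "k = l" using v(1) w(1) k(1) l(1) by (auto simp: lev_def split: if_splits)
    moreover from this have "p = q"
      using Q(2)[of k] k(2) l(2) v(2) w(2) vw unfolding disjoint_family_on_def by blast
    ultimately show False using rs(3) k(3) l(3) by simp
  qed
  moreover have "(\<Union>r\<in>R. cone r) = E"
  proof
    show "(\<Union>r\<in>R. cone r) \<subseteq> E"
    proof
      fix z assume "z \<in> (\<Union>r\<in>R. cone r)"
      then obtain k p where k: "k \<le> N" "p \<in> Q k" "z \<in> cone (T k p)" unfolding R_def by blast
      then obtain i v where v: "i \<in> lev k" "v \<in> cone p" "z = v + Poly_Mapping.single x i"
        using coneT by auto
      have "k \<le> i" using v(1) by (auto simp: lev_def split: if_splits)
      then have "v \<in> sl i" using v(2) cQ[OF k(2)] mono by blast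
      then show "z \<in> E" using v(3) by (simp add: sl_def)
    qed
    show "E \<subseteq> (\<Union>r\<in>R. cone r)"
    proof
      fix z assume z: "z \<in> E"
      let ?j = "Poly_Mapping.lookup z x"
      define v where "v = z - Poly_Mapping.single x ?j"
      have eq: "z = v + Poly_Mapping.single x ?j"
        by (rule poly_mapping_eqI) (simp add: v_def lookup_add lookup_minus lookup_single when_def)
      have "Poly_Mapping.keys v \<subseteq> V"
      proof
        fix i assume "i \<in> Poly_Mapping.keys v"
        then have "i \<in> Poly_Mapping.keys z" "i \<noteq> x"
          by (auto simp: v_def in_keys_iff lookup_minus lookup_single when_def split: if_splits)
        then show "i \<in> V" using insert.prems(1) z by blast
      qed
      then have v: "v \<in> sl ?j" using z eq by (simp add: sl_def)
      \<comment> \<open>Every height from \<open>N\<close> on is served by the cones of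
        \<open>Q N\<close>, because \<open>sl N\<close> contains all slices.\<close>
      define k where "k = min ?j N"
      have "v \<in> sl k" using v stable by (auto simp: k_def min_def)
      then obtain p where p: "p \<in> Q k" "v \<in> cone p" using Q(3) by blast
      have "?j \<in> lev k" by (auto simp: k_def lev_def min_def)
      then have "z \<in> cone (T k p)" using coneT p(2) eq by blast
      moreover have "T k p \<in> R" using p(1) unfolding R_def k_def by auto
      ultimately show "z \<in> (\<Union>r\<in>R. cone r)" by blast
    qed
  qed
  ultimately show ?case by blast
qed

section \<open>Stanley spaces\<close>

lemma poly_mapping_sum_single:
  "(\<Sum>k\<in>Poly_Mapping.keys f. Poly_Mapping.single k (Poly_Mapping.lookup f k)) = f"
  by (rule poly_mapping_eqI)
    (simp add: lookup_sum lookup_single when_def sum.delta' in_keys_iff)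

text \<open>Convolution over the two finite supports, from expanding both factors into terms. The
  explicit test on \<open>a + b\<close> allows later sums to collapse to one term.\<close>

lemma lookup_times:
  fixes f h :: "'a::cancel_comm_monoid_add \<Rightarrow>\<^sub>0 'b::comm_semiring_0"
  shows "Poly_Mapping.lookup (f * h) k = (\<Sum>a\<in>Poly_Mapping.keys f. \<Sum>b\<in>Poly_Mapping.keys h.
    if a + b = k then Poly_Mapping.lookup f a * Poly_Mapping.lookup h b else 0)"
proof -
  have "f * h = (\<Sum>a\<in>Poly_Mapping.keys f. Poly_Mapping.single a (Poly_Mapping.lookup f a)) *
      (\<Sum>b\<in>Poly_Mapping.keys h. Poly_Mapping.single b (Poly_Mapping.lookup h b))"
    by (simp only: poly_mapping_sum_single)
  then show ?thesis
    by (simp add: sum_product Poly_Mapping.mult_single lookup_sum lookup_single when_def)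
qed

text \<open>Cancelling \<open>u\<close> leaves a single term of the convolution. The case
  \<open>c = 0\<close> is separate because the second factor then has empty support.\<close>

lemma lookup_times_single:
  fixes p :: "('a, 'k::field) mvpoly"
  shows "Poly_Mapping.lookup (p * Poly_Mapping.single u c) (u + w) = Poly_Mapping.lookup p w * c"
proof (cases "c = 0")
  case False
  have "Poly_Mapping.lookup (p * Poly_Mapping.single u c) (u + w) =
      (\<Sum>a\<in>Poly_Mapping.keys p. if a = w then Poly_Mapping.lookup p a * c else 0)"
    unfolding lookup_times keys_single using False by (simp add: add.commute[of u])
  then show ?thesis by (simp add: sum.delta in_keys_iff)
qed simp

lemma times_single_eq_0:
  fixes p :: "('a, 'k::field) mvpoly"
  assumes "p * Poly_Mapping.single u c = 0" "c \<noteq> 0"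
  shows "p = 0"
  using assms lookup_times_single[of p u c] by (intro poly_mapping_eqI) simp

text \<open>Multiplication by a nonzero term shifts supports by \<open>u\<close>, and a polynomial
  supported on the cone can be divided by that term. Stanley spaces thus become sets of
  exponents.\<close>

lemma stanley_space_single:
  fixes c :: "'k::field"
  assumes "c \<noteq> 0"
  shows "stanley_space (*) (Poly_Mapping.single u c) Z = {f. Poly_Mapping.keys f \<subseteq> cone (u, Z)}"
proof
  show "stanley_space (*) (Poly_Mapping.single u c) Z \<subseteq> {f. Poly_Mapping.keys f \<subseteq> cone (u, Z)}"
  proof
    fix f assume "f \<in> stanley_space (*) (Poly_Mapping.single u c) Z"
    then obtain p where p: "p \<in> polys_in Z" "f = p * Poly_Mapping.single u c"
      unfolding stanley_space_def by blast
    have "k \<in> cone (u, Z)" if k: "k \<in> Poly_Mapping.keys f" for k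
    proof -
      obtain a where "a \<in> Poly_Mapping.keys p" "k = a + u"
        using k keys_mult[of p "Poly_Mapping.single u c"] p(2) by (auto split: if_splits)
      then show ?thesis using p(1) unfolding polys_in_def cone_def by (auto simp: add.commute)
    qed
    then show "f \<in> {f. Poly_Mapping.keys f \<subseteq> cone (u, Z)}" by blast
  qed
  show "{f. Poly_Mapping.keys f \<subseteq> cone (u, Z)} \<subseteq> stanley_space (*) (Poly_Mapping.single u c) Z"
  proof
    fix f :: "('a, 'k) mvpoly" assume "f \<in> {f. Poly_Mapping.keys f \<subseteq> cone (u, Z)}"
    then have f: "\<exists>w. k = u + w \<and> Poly_Mapping.keys w \<subseteq> Z" if "k \<in> Poly_Mapping.keys f" for k
      using that unfolding cone_def by auto
    \<comment> \<open>This is the termwise quotient of \<open>f\<close> by the given term. The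
      truncated subtraction \<open>k - u\<close> is exact because every exponent of \<open>f\<close>
      has \<open>u\<close> as a summand.\<close>
    define p where "p = (\<Sum>k\<in>Poly_Mapping.keys f.
      Poly_Mapping.single (k - u) (Poly_Mapping.lookup f k / c))"
    have "p * Poly_Mapping.single u c =
        (\<Sum>k\<in>Poly_Mapping.keys f. Poly_Mapping.single k (Poly_Mapping.lookup f k))"
      unfolding p_def sum_distrib_right
    proof (rule sum.cong)
      fix k assume "k \<in> Poly_Mapping.keys f"
      then have "k - u + u = k" using f[of k] by (auto simp: add.commute)
      then show "Poly_Mapping.single (k - u) (Poly_Mapping.lookup f k / c) * Poly_Mapping.single u c =
          Poly_Mapping.single k (Poly_Mapping.lookup f k)"
        using assms by (simp add: Poly_Mapping.mult_single)
    qed simp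
    then have "f = p * Poly_Mapping.single u c" by (simp only: poly_mapping_sum_single)
    moreover have "p \<in> polys_in Z"
    proof -
      have "Poly_Mapping.keys a \<subseteq> Z" if "a \<in> Poly_Mapping.keys p" for a
      proof -
        have "a \<in> (\<Union>k\<in>Poly_Mapping.keys f. Poly_Mapping.keys
            (Poly_Mapping.single (k - u) (Poly_Mapping.lookup f k / c)))"
          using that unfolding p_def by (rule subsetD[OF keys_sum])
        then obtain k where "k \<in> Poly_Mapping.keys f" "a = k - u" by (auto split: if_splits)
        then show ?thesis using f[of k] by auto
      qed
      then show ?thesis unfolding polys_in_def by blast
    qed
    ultimately show "f \<in> stanley_space (*) (Poly_Mapping.single u c) Z"
      unfolding stanley_space_def by blast
  qed
qed

lemma multidegree_comp_single:
  "Poly_Mapping.single u c \<in> multidegree_comp (\<lambda>i. int (Poly_Mapping.lookup u i))"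
  by (simp add: multidegree_comp_def)

text \<open>The multidegree determines the exponent vector, so a graded component has dimension at
  most one over the field.\<close>

lemma multidegree_comp_nonzero:
  fixes m :: "('n, 'k::field) mvpoly"
  assumes "m \<in> multidegree_comp a" "m \<noteq> 0"
  obtains u c where "c \<noteq> 0" "m = Poly_Mapping.single u c"
proof -
  obtain u where u: "u \<in> Poly_Mapping.keys m" using assms(2) by (metis keys_eq_empty ex_in_conv)
  have "v = u" if "v \<in> Poly_Mapping.keys m" for v
    using assms(1) u that unfolding multidegree_comp_def
    by (intro poly_mapping_eqI) (metis (mono_tags, lifting) mem_Collect_eq of_nat_eq_iff)
  then have "Poly_Mapping.keys m = {u}" using u by blast
  then have "m = Poly_Mapping.single u (Poly_Mapping.lookup m u)"
    using poly_mapping_sum_single[of m] by simp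
  then show ?thesis using that u by (simp add: in_keys_iff)
qed

text \<open>A polynomial supported on a disjoint union of cones splits uniquely into its
  restrictions to the single cones.\<close>

lemma stanley_decomposition_of_cones:
  assumes "finite P" "disjoint_family_on cone P"
  shows "\<exists>D. stanley_decomposition (*) multidegree_comp
    {f :: ('n, 'k::field) mvpoly. Poly_Mapping.keys f \<subseteq> (\<Union>p\<in>P. cone p)} D \<and> length D = card P"
proof -
  obtain ps where ps: "set ps = P" "distinct ps" "length ps = card P"
    using assms(1) finite_distinct_list distinct_card by metis
  define D where "D = map (\<lambda>(u, Z). (mono_of u :: ('n, 'k) mvpoly, Z)) ps"
  define n where "n = length ps"
  let ?M = "{f :: ('n, 'k) mvpoly. Poly_Mapping.keys f \<subseteq> (\<Union>p\<in>P. cone p)}"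
  define F :: "nat \<Rightarrow> ('n, 'k) mvpoly set" where "F i = {f. Poly_Mapping.keys f \<subseteq> cone (ps ! i)}" for i
  have n: "length D = n" by (simp add: D_def n_def)
  have un: "(\<Union>p\<in>P. cone p) = (\<Union>i<n. cone (ps ! i))"
    unfolding ps(1)[symmetric] set_conv_nth n_def by blast
  have disj: "i = j" if "i < n" "j < n" "k \<in> cone (ps ! i)" "k \<in> cone (ps ! j)" for i j k
  proof -
    have "ps ! i = ps ! j"
      using that assms(2) ps(1) unfolding disjoint_family_on_def n_def by (metis disjoint_iff nth_mem)
    then show ?thesis using that ps(2) nth_eq_iff_index_eq n_def by blast
  qed
  have sp: "stanley_space (*) (fst (D ! i)) (snd (D ! i)) = F i" if "i < n" for i
    using that stanley_space_single[of "1::'k" "fst (ps ! i)" "snd (ps ! i)"]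
    by (simp add: D_def n_def F_def case_prod_beta)
  \<comment> \<open>By disjointness only the \<open>i\<close>-th summand has coefficients on the
    \<open>i\<close>-th cone, so the sum determines it there.\<close>
  have look: "Poly_Mapping.lookup (\<Sum>j<n. g j) k = Poly_Mapping.lookup (g i) k"
    if g: "g \<in> (\<Pi>\<^sub>E i\<in>{..<n}. F i)" and i: "i < n" and k: "k \<in> cone (ps ! i)" for g i k
  proof -
    have "Poly_Mapping.lookup (g j) k = 0" if "j < n" "j \<noteq> i" for j
    proof -
      have "g j \<in> F j" using g \<open>j < n\<close> by auto
      then show ?thesis using disj[of i j k] i k that unfolding F_def by (auto simp: in_keys_iff)
    qed
    then have "(\<Sum>j<n. Poly_Mapping.lookup (g j) k) =
        (\<Sum>j<n. if j = i then Poly_Mapping.lookup (g i) k else 0)"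
      by (intro sum.cong) auto
    then show ?thesis using i by (simp add: lookup_sum sum.delta)
  qed
  have bij: "bij_betw (\<lambda>g. \<Sum>i<n. g i) (\<Pi>\<^sub>E i\<in>{..<n}. F i) ?M"
    unfolding bij_betw_def
  proof
    show "inj_on (\<lambda>g. \<Sum>i<n. g i) (\<Pi>\<^sub>E i\<in>{..<n}. F i)"
    proof (rule inj_onI)
      fix g h assume g: "g \<in> (\<Pi>\<^sub>E i\<in>{..<n}. F i)" and h: "h \<in> (\<Pi>\<^sub>E i\<in>{..<n}. F i)"
        and eq: "(\<Sum>i<n. g i) = (\<Sum>i<n. h i)"
      show "g = h"
      proof (rule PiE_ext[OF g h])
        fix i assume i: "i \<in> {..<n}"
        show "g i = h i"
        proof (rule poly_mapping_eqI)
          fix k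
          show "Poly_Mapping.lookup (g i) k = Poly_Mapping.lookup (h i) k"
          proof (cases "k \<in> cone (ps ! i)")
            case True
            then show ?thesis using look[OF g, of i k] look[OF h, of i k] eq i by simp
          next
            case False
            have "g i \<in> F i" "h i \<in> F i" using g h i by auto
            then have "k \<notin> Poly_Mapping.keys (g i)" "k \<notin> Poly_Mapping.keys (h i)"
              using False unfolding F_def by blast+
            then show ?thesis by (simp add: in_keys_iff)
          qed
        qed
      qed
    qed
    show "(\<lambda>g. \<Sum>i<n. g i) ` (\<Pi>\<^sub>E i\<in>{..<n}. F i) = ?M"
    proof
      show "(\<lambda>g. \<Sum>i<n. g i) ` (\<Pi>\<^sub>E i\<in>{..<n}. F i) \<subseteq> ?M"
      proof clarify
        fix g k assume g: "g \<in> (\<Pi>\<^sub>E i\<in>{..<n}. F i)" and "k \<in> Poly_Mapping.keys (\<Sum>i<n. g i)"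
        then obtain i where i: "i < n" "k \<in> Poly_Mapping.keys (g i)"
          using keys_sum[of g "{..<n}"] by blast
        then have "g i \<in> F i" using g by auto
        then show "k \<in> (\<Union>p\<in>P. cone p)" using i un unfolding F_def by blast
      qed
      show "?M \<subseteq> (\<lambda>g. \<Sum>i<n. g i) ` (\<Pi>\<^sub>E i\<in>{..<n}. F i)"
      proof
        fix f assume f: "f \<in> ?M"
        \<comment> \<open>The \<open>i\<close>-th component restricts \<open>f\<close> to the
          \<open>i\<close>-th cone. Outside \<open>{..<n}\<close> the family is
          \<open>undefined\<close>, as the extensional product demands.\<close>
        define g where "g = (\<lambda>i\<in>{..<n}. Poly_Mapping.mapp (\<lambda>k c. c when k \<in> cone (ps ! i)) f)"
        have lg: "Poly_Mapping.lookup (g i) k = (Poly_Mapping.lookup f k when k \<in> cone (ps ! i))"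
          if "i < n" for i k
          using that by (simp add: g_def lookup_mapp when_def in_keys_iff)
        have g: "g \<in> (\<Pi>\<^sub>E i\<in>{..<n}. F i)"
        proof (rule PiE_I)
          fix i assume "i \<in> {..<n}"
          then show "g i \<in> F i" unfolding F_def by (auto simp: in_keys_iff lg when_def split: if_splits)
        qed (simp add: g_def)
        have "(\<Sum>i<n. g i) = f"
        proof (rule poly_mapping_eqI)
          fix k
          show "Poly_Mapping.lookup (\<Sum>i<n. g i) k = Poly_Mapping.lookup f k"
          proof (cases "k \<in> Poly_Mapping.keys f")
            case True
            then obtain i where "i < n" "k \<in> cone (ps ! i)" using f un by blast
            then show ?thesis using look[OF g] lg by simp
          next
            case False
            then show ?thesis by (simp add: lookup_sum lg in_keys_iff)
          qed
        qed
        then show "f \<in> (\<lambda>g. \<Sum>i<n. g i) ` (\<Pi>\<^sub>E i\<in>{..<n}. F i)" using g by blast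
      qed
    qed
  qed
  have "(\<Pi>\<^sub>E i\<in>{..<n}. stanley_space (*) (fst (D ! i)) (snd (D ! i))) = (\<Pi>\<^sub>E i\<in>{..<n}. F i)"
    by (rule PiE_cong) (simp add: sp)
  then have bij': "bij_betw (\<lambda>g. \<Sum>i<n. g i)
      (\<Pi>\<^sub>E i\<in>{..<n}. stanley_space (*) (fst (D ! i)) (snd (D ! i))) ?M"
    using bij by (simp only:)
  have base: "m \<in> ?M \<and> (\<exists>a. m \<in> multidegree_comp a) \<and> (\<forall>p\<in>polys_in Z. p * m = 0 \<longrightarrow> p = 0)"
    if mZ: "(m, Z) \<in> set D" for m Z
  proof -
    obtain u where u: "(u, Z) \<in> P" "m = mono_of u" using mZ ps(1) by (auto simp: D_def)
    have "m \<in> ?M" using u apex_in_cone[of u Z] by auto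
    moreover have "m \<in> multidegree_comp (\<lambda>i. int (Poly_Mapping.lookup u i))"
      unfolding u(2) by (rule multidegree_comp_single)
    moreover have "p = 0" if "p * m = 0" for p
      using times_single_eq_0[of p u 1] that u(2) by simp
    ultimately show ?thesis by blast
  qed
  have "\<forall>(m, Z)\<in>set D. m \<in> ?M \<and> (\<exists>a. m \<in> multidegree_comp a) \<and>
      (\<forall>p\<in>polys_in Z. p * m = 0 \<longrightarrow> p = 0)"
  proof
    fix d assume "d \<in> set D"
    moreover obtain m Z where d: "d = (m, Z)" by fastforce
    ultimately have "(m, Z) \<in> set D" by simp
    then show "case d of (m, Z) \<Rightarrow> m \<in> ?M \<and> (\<exists>a. m \<in> multidegree_comp a) \<and>
        (\<forall>p\<in>polys_in Z. p * m = 0 \<longrightarrow> p = 0)"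
      unfolding d prod.case by (rule base)
  qed
  with bij' have "stanley_decomposition (*) multidegree_comp ?M D"
    unfolding stanley_decomposition_def n by (intro conjI)
  then show ?thesis using ps(3) n n_def by auto
qed

text \<open>Freeness applied to \<open>1\<close> excludes \<open>m = 0\<close>; a nonzero
  homogeneous element is a single term.\<close>

lemma stanley_decomposition_memD:
  fixes M :: "('n, 'k::field) mvpoly set"
  assumes "stanley_decomposition (*) multidegree_comp M D" "(m, Z) \<in> set D"
  obtains u c where "c \<noteq> 0" "m = Poly_Mapping.single u c" "m \<in> M"
proof -
  obtain a where a: "m \<in> M" "m \<in> multidegree_comp a" "\<forall>p\<in>polys_in Z. p * m = 0 \<longrightarrow> p = 0"
    using assms unfolding stanley_decomposition_def by blast
  have one: "(1 :: ('n, 'k) mvpoly) \<in> polys_in Z" by (simp add: polys_in_def)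
  have "m \<noteq> 0"
  proof
    assume "m = 0"
    then have "1 * m = 0" by simp
    then have "(1 :: ('n, 'k) mvpoly) = 0" using bspec[OF a(3) one] by simp
    then show False by simp
  qed
  with a(2) obtain u c where "c \<noteq> 0" "m = Poly_Mapping.single u c"
    by (rule multidegree_comp_nonzero)
  then show ?thesis using a(1) by (rule that)
qed

section \<open>Monomial ideals\<close>

text \<open>Polynomials whose monomials all lie in \<open>I\<close> form a submodule that contains
  the monomial generators; conversely, a polynomial is a linear combination of its monomials.
  Membership in \<open>I\<close> therefore depends only on the support.\<close>

lemma monomial_ideal_upset_iff:
  fixes I :: "('n, 'k::field) mvpoly set"
  assumes "monomial_ideal I"
  shows "f \<in> I \<longleftrightarrow> Poly_Mapping.keys f \<subseteq> {v. mono_of v \<in> I}"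
    and "mono_of u \<in> I \<Longrightarrow> mono_of (u + w) \<in> I"
proof -
  interpret module "(*) :: ('n, 'k) mvpoly \<Rightarrow> _ \<Rightarrow> _" by (rule module_times)
  obtain C where C: "C \<subseteq> range mono_of" "I = span C" using assms monomial_ideal_def by blast
  have up: "mono_of (u + w) \<in> I" if "mono_of u \<in> I" for u w
  proof -
    have "mono_of (u + w) = mono_of w * (mono_of u :: ('n, 'k) mvpoly)"
      by (simp add: Poly_Mapping.mult_single add.commute)
    then show ?thesis using that C(2) by (simp add: span_scale)
  qed
  then show "mono_of u \<in> I \<Longrightarrow> mono_of (u + w) \<in> I" .
  let ?T = "{f :: ('n, 'k) mvpoly. Poly_Mapping.keys f \<subseteq> {v. mono_of v \<in> I}}"
  have "subspace ?T"
  proof (rule subspaceI)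
    fix x y assume "x \<in> ?T" "y \<in> ?T"
    then show "x + y \<in> ?T" using Poly_Mapping.keys_add[of x y] by blast
  next
    fix c x assume x: "x \<in> ?T"
    have "mono_of k \<in> I" if k: "k \<in> Poly_Mapping.keys (c * x)" for k
    proof -
      obtain a b where "k = a + b" "b \<in> Poly_Mapping.keys x"
        using k Poly_Mapping.keys_mult[of c x] by blast
      then show ?thesis using x up[of b a] by (auto simp: add.commute)
    qed
    then show "c * x \<in> ?T" by blast
  qed simp
  moreover have "C \<subseteq> ?T"
  proof
    fix c assume c: "c \<in> C"
    then obtain v where "c = mono_of v" using C(1) by blast
    then show "c \<in> ?T" using c C(2) span_base by auto
  qed
  ultimately have "I \<subseteq> ?T" using C(2) span_minimal by blast
  moreover have "f \<in> I" if f: "f \<in> ?T" for f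
  proof -
    have "Poly_Mapping.single k (Poly_Mapping.lookup f k) \<in> span C" if "k \<in> Poly_Mapping.keys f" for k
    proof -
      have "Poly_Mapping.single k (Poly_Mapping.lookup f k) =
          Poly_Mapping.single 0 (Poly_Mapping.lookup f k) * mono_of k"
        by (simp add: Poly_Mapping.mult_single)
      then show ?thesis using f that C(2) span_scale by auto
    qed
    then show ?thesis
      using C(2) span_sum[of "Poly_Mapping.keys f"
        "\<lambda>k. Poly_Mapping.single k (Poly_Mapping.lookup f k)"]
      by (simp only: poly_mapping_sum_single)
  qed
  ultimately show "f \<in> I \<longleftrightarrow> Poly_Mapping.keys f \<subseteq> {v. mono_of v \<in> I}" by blast
qed

text \<open>Some generator, of exponent \<open>a\<close>, divides \<open>mono_of u\<close>. If
  \<open>w\<close> were nonzero, it would differ from \<open>mono_of (u + w)\<close> and still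
  divide it, so that \<open>mono_of (u + w)\<close> could be dropped from \<open>G\<close>.\<close>

lemma minimal_generatorD:
  fixes I :: "('n, 'k::field) mvpoly set"
  assumes G: "minimal_monomial_generating_set I G" and "mono_of (u + w) \<in> G" "mono_of u \<in> I"
  shows "w = 0"
proof (rule ccontr)
  interpret module "(*) :: ('n, 'k) mvpoly \<Rightarrow> _ \<Rightarrow> _" by (rule module_times)
  assume w: "w \<noteq> 0"
  let ?m = "mono_of :: 'n expo \<Rightarrow> ('n, 'k) mvpoly"
  let ?H = "G - {?m (u + w)}"
  have span: "span G = I" and "G \<subseteq> range ?m"
    using G unfolding minimal_monomial_generating_set_def by blast+
  then obtain A where A: "G = ?m ` A" by (meson subset_imageE)
  then obtain a b where ab: "a \<in> A" "u = a + b"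
    using assms(3) span mono_mem_ideal_gen[of u A] by blast
  have "?m a \<noteq> ?m (u + w)"
  proof
    assume "?m a = ?m (u + w)"
    then have "Poly_Mapping.keys (?m a) = Poly_Mapping.keys (?m (u + w))" by (rule arg_cong)
    then have "a + 0 = a + (b + w)" unfolding ab(2) by (simp add: add.assoc)
    then have "b + w = 0" by (metis add_left_imp_eq)
    then have "Poly_Mapping.keys w = {}" using keys_add_nat[of b w] by simp
    then show False using w by simp
  qed
  then have "?m a \<in> ?H" using ab A by blast
  then have "?m (b + w) * ?m a \<in> span ?H" by (intro span_scale span_base)
  moreover have "?m (b + w) * ?m a = ?m (u + w)"
    using ab(2) by (simp add: Poly_Mapping.mult_single ac_simps)
  ultimately have gen: "?m (u + w) \<in> span ?H" by (simp only:)
  have "G \<subseteq> span ?H"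
  proof
    fix g assume "g \<in> G"
    then show "g \<in> span ?H" using gen by (cases "g = ?m (u + w)") (simp_all add: span_base)
  qed
  then have "span G \<subseteq> span ?H" by (simp add: span_minimal)
  moreover have "span ?H \<subseteq> span G" by (rule span_mono) blast
  ultimately have "span ?H = I" using span by blast
  moreover have "?H \<subset> G" using assms(2) by blast
  ultimately show False using G unfolding minimal_monomial_generating_set_def by blast
qed

section \<open>Existence of Stanley decompositions and the lower bound on their length\<close>

lemma stanley_decomposition_exists:
  fixes I :: "('n::finite, 'k::field) mvpoly set"
  assumes "monomial_ideal I"
  shows "\<exists>D. stanley_decomposition (*) multidegree_comp I D"
proof -
  obtain P where P: "finite P" "disjoint_family_on cone P" "(\<Union>p\<in>P. cone p) = {v. mono_of v \<in> I}"
    using upset_disjoint_cones[of UNIV "{v. mono_of v \<in> I}"] monomial_ideal_upset_iff(2)[OF assms] by auto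
  have "I = {f. Poly_Mapping.keys f \<subseteq> (\<Union>p\<in>P. cone p)}"
    unfolding P(3) using monomial_ideal_upset_iff(1)[OF assms] by blast
  then show ?thesis
    using stanley_decomposition_of_cones[OF P(1,2), where 'k = 'k] by metis
qed

text \<open>Every minimal generator is the apex of one of the \<open>length D\<close> cones. Apices
  are compared through \<open>keys\<close>, since a homogeneous element of the decomposition may be
  a scalar multiple of the monomial.\<close>

lemma card_minimal_generating_set_le:
  fixes I :: "('n, 'k::field) mvpoly set"
  assumes I: "monomial_ideal I" and G: "minimal_monomial_generating_set I G"
    and D: "stanley_decomposition (*) multidegree_comp I D"
  shows "card G \<le> length D"
proof -
  interpret module "(*) :: ('n, 'k) mvpoly \<Rightarrow> _ \<Rightarrow> _" by (rule module_times)
  have "\<exists>i<length D. Poly_Mapping.keys (fst (D ! i)) = Poly_Mapping.keys g" if g: "g \<in> G" for g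
  proof -
    obtain v where v: "g = mono_of v"
      using G g unfolding minimal_monomial_generating_set_def by blast
    have "g \<in> I" using G g span_base unfolding minimal_monomial_generating_set_def by blast
    then obtain h where h: "h \<in> (\<Pi>\<^sub>E i\<in>{..<length D}. stanley_space (*) (fst (D ! i)) (snd (D ! i)))"
      "g = (\<Sum>i<length D. h i)"
      using D unfolding stanley_decomposition_def bij_betw_def by blast
    have "v \<in> Poly_Mapping.keys (\<Sum>i<length D. h i)" using h(2) v by (metis keys_single insertI1 one_neq_zero)
    then obtain i where i: "i < length D" "v \<in> Poly_Mapping.keys (h i)"
      using keys_sum[of h "{..<length D}"] by blast
    obtain m Z where mZ: "D ! i = (m, Z)" by fastforce
    then have "(m, Z) \<in> set D" using i(1) nth_mem by metis
    then obtain u c where u: "c \<noteq> 0" "m = Poly_Mapping.single u c" "m \<in> I"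
      by (rule stanley_decomposition_memD[OF D])
    have "h i \<in> stanley_space (*) m Z" using PiE_mem[OF h(1), of i] i(1) mZ by simp
    then have "Poly_Mapping.keys (h i) \<subseteq> cone (u, Z)"
      unfolding u(2) stanley_space_single[OF u(1)] by simp
    then have "v \<in> cone (u, Z)" using i(2) by blast
    then obtain w where w: "v = u + w" unfolding cone_def by auto
    have "Poly_Mapping.keys m \<subseteq> {v. mono_of v \<in> I}"
      using u(3) monomial_ideal_upset_iff(1)[OF I] by blast
    then have "mono_of u \<in> I" using u(1,2) by simp
    then have "w = 0" using minimal_generatorD[OF G, of u w] g v w by simp
    then have "Poly_Mapping.keys (fst (D ! i)) = Poly_Mapping.keys g" using mZ u v w by simp
    then show ?thesis using i(1) by blast
  qed
  then have sub: "Poly_Mapping.keys ` G \<subseteq> (\<lambda>i. Poly_Mapping.keys (fst (D ! i))) ` {..<length D}"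
    by (metis (no_types, lifting) image_eqI image_subsetI lessThan_iff)
  have "inj_on Poly_Mapping.keys G"
  proof (rule inj_onI)
    fix g h assume gh: "g \<in> G" "h \<in> G" "Poly_Mapping.keys g = Poly_Mapping.keys h"
    have "G \<subseteq> range mono_of" using G unfolding minimal_monomial_generating_set_def by blast
    then obtain a b where ab: "g = mono_of a" "h = mono_of b" using gh(1,2) by blast
    show "g = h" using gh(3) unfolding ab by simp
  qed
  then have "card G = card (Poly_Mapping.keys ` G)" by (simp add: card_image)
  also have "\<dots> \<le> card {..<length D}" by (rule surj_card_le[OF _ sub]) simp
  finally show ?thesis by simp
qed

section \<open>Principal ideals and decompositions of length one\<close>

text \<open>The generator \<open>f\<close> may have several terms a priori. The argument therefore
  compares coefficients at minimal exponents, where a product \<open>f * h\<close> sees only the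
  constant coefficient of \<open>h\<close>.\<close>

lemma principal_minimal_generating_set:
  fixes I :: "('n, 'k::field) mvpoly set"
  assumes I: "monomial_ideal I" and "principal_ideal I" "I \<noteq> {0}"
    and G: "minimal_monomial_generating_set I G"
  obtains u where "G = {mono_of u}"
proof -
  interpret module "(*) :: ('n, 'k) mvpoly \<Rightarrow> _ \<Rightarrow> _" by (rule module_times)
  obtain f where f: "I = span {f}" using assms(2) principal_ideal_def by blast
  have keysf: "mono_of a \<in> I" if "a \<in> Poly_Mapping.keys f" for a
    using f span_base[of f "{f}"] monomial_ideal_upset_iff(1)[OF I] that by blast
  have Gr: "G \<subseteq> range mono_of" and Gs: "span G = I"
    using G unfolding minimal_monomial_generating_set_def by blast+
  \<comment> \<open>Minimality of \<open>v\<close> leaves only one term in the convolution.\<close>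
  have coeff: "Poly_Mapping.lookup (f * h) v = Poly_Mapping.lookup f v * Poly_Mapping.lookup h 0"
    if v: "mono_of v \<in> G" for h v
  proof -
    have "a + b = v \<longleftrightarrow> a = v \<and> b = 0" if "a \<in> Poly_Mapping.keys f" for a b
      using minimal_generatorD[OF G, of a b] keysf[OF that] v by auto
    then have "Poly_Mapping.lookup (f * h) v = (\<Sum>a\<in>Poly_Mapping.keys f. \<Sum>b\<in>Poly_Mapping.keys h.
        if a = v then (if b = 0 then Poly_Mapping.lookup f a * Poly_Mapping.lookup h b else 0) else 0)"
      unfolding lookup_times by (intro sum.cong refl) auto
    also have "\<dots> = (\<Sum>a\<in>Poly_Mapping.keys f. if a = v then
        (\<Sum>b\<in>Poly_Mapping.keys h. if b = 0 then Poly_Mapping.lookup f a * Poly_Mapping.lookup h b else 0) else 0)"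
      by (intro sum.cong refl) auto
    also have "\<dots> = Poly_Mapping.lookup f v * Poly_Mapping.lookup h 0"
      by (simp add: sum.delta in_keys_iff)
    finally show ?thesis .
  qed
  have "\<exists>h. mono_of v = f * h" if "mono_of v \<in> G" for v
  proof -
    have "mono_of v \<in> span {f}" using that Gs f span_base by blast
    then show ?thesis by (auto simp: span_singleton mult.commute)
  qed
  then obtain h where h: "\<And>v. mono_of v \<in> G \<Longrightarrow> mono_of v = f * h v" by metis
  have nz: "Poly_Mapping.lookup f v \<noteq> 0 \<and> Poly_Mapping.lookup (h v) 0 \<noteq> 0" if "mono_of v \<in> G" for v
    using coeff[OF that, of "h v"] h[OF that] by (metis lookup_single_eq mult_eq_0_iff one_neq_zero)
  \<comment> \<open>The coefficient of \<open>f * h u = mono_of u\<close> at another minimal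
    exponent \<open>v\<close> is zero, yet by \<open>coeff\<close> it is the product of two nonzero
    scalars.\<close>
  have eq: "u = v" if "mono_of u \<in> G" "mono_of v \<in> G" for u v
  proof (rule ccontr)
    assume "u \<noteq> v"
    then have "Poly_Mapping.lookup (f * h u) v = 0"
      using h[OF that(1)] by (metis lookup_single_not_eq)
    then show False using coeff[OF that(2), of "h u"] nz that by simp
  qed
  have "G \<noteq> {}" using Gs assms(3) by auto
  then obtain u where "mono_of u \<in> G" using Gr by blast
  then have "G = {mono_of u}" using eq Gr by blast
  then show ?thesis using that by blast
qed

text \<open>With a single minimal generator the exponents of \<open>I\<close> form one cone, open in
  all directions.\<close>

lemma principal_stanley_decomposition:
  fixes I :: "('n::finite, 'k::field) mvpoly set"
  assumes I: "monomial_ideal I" and "principal_ideal I" "I \<noteq> {0}"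
  shows "\<exists>D. stanley_decomposition (*) multidegree_comp I D \<and> length D = 1"
proof -
  obtain G where G: "minimal_monomial_generating_set I G"
    using ex1_minimal_monomial_generating_set[OF I] by blast
  then obtain u where "G = {mono_of u}" using principal_minimal_generating_set[OF assms] by blast
  then have "I = ideal_gen (mono_of ` {u})"
    using G unfolding minimal_monomial_generating_set_def by simp
  then have "{v. mono_of v \<in> I} = cone (u, UNIV)"
    using mono_mem_ideal_gen[of _ "{u}", where 'k = 'k] unfolding cone_def by auto
  then have "I = {f. Poly_Mapping.keys f \<subseteq> (\<Union>p\<in>{(u, UNIV)}. cone p)}"
    using monomial_ideal_upset_iff(1)[OF I] by blast
  then show ?thesis
    using stanley_decomposition_of_cones[of "{(u, UNIV)}", where 'k = 'k]
    by (simp add: disjoint_family_on_def)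
qed

text \<open>The product over no indices has exactly one element, and its sum is \<open>0\<close>.
  This rules out length zero for nonzero ideals.\<close>

lemma stanley_decomposition_length_0:
  assumes "stanley_decomposition sc gr M []"
  shows "M = {0}"
  using assms unfolding stanley_decomposition_def bij_betw_def by auto

text \<open>The ideal equals the Stanley space of \<open>m\<close>, which lies in the ideal
  generated by \<open>m\<close>, and that ideal lies in \<open>I\<close>.\<close>

lemma stanley_decomposition_length_1:
  fixes I :: "('n, 'k::field) mvpoly set"
  assumes I: "monomial_ideal I" and D: "stanley_decomposition (*) multidegree_comp I [(m, Z)]"
  shows "principal_ideal I"
proof -
  interpret module "(*) :: ('n, 'k) mvpoly \<Rightarrow> _ \<Rightarrow> _" by (rule module_times)
  have "I \<subseteq> span {m}"
  proof
    fix f assume "f \<in> I"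
    then obtain g where g: "g \<in> (\<Pi>\<^sub>E i\<in>{..<Suc 0}. stanley_space (*) (fst ([(m, Z)] ! i)) (snd ([(m, Z)] ! i)))"
      "f = (\<Sum>i<Suc 0. g i)"
      using D unfolding stanley_decomposition_def bij_betw_def by auto
    have "f = g 0" using g(2) by simp
    moreover have "g 0 \<in> stanley_space (*) m Z" using PiE_mem[OF g(1), of 0] by simp
    ultimately have "f \<in> stanley_space (*) m Z" by simp
    then show "f \<in> span {m}" unfolding stanley_space_def by (auto simp: span_singleton)
  qed
  moreover have "span {m} \<subseteq> I"
  proof (rule span_minimal)
    show "{m} \<subseteq> I" using D unfolding stanley_decomposition_def by auto
    show "subspace I" using I unfolding monomial_ideal_def by auto
  qed
  ultimately show ?thesis unfolding principal_ideal_def by blast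
qed

text \<open>The zero ideal is generated by \<open>0\<close> but has the empty decomposition, of
  length 0; hence the equivalence is stated for nonzero ideals.\<close>

theorem proposition2p2:
  fixes I :: "('n::finite, 'k::field) mvpoly set"
  assumes "monomial_ideal I"
  shows "ideal_slength I \<ge> card (minimal_generators I) \<and>
    (I \<noteq> {0} \<longrightarrow> (principal_ideal I \<longleftrightarrow> ideal_slength I = 1))"
proof -
  \<comment> \<open>Existence of a decomposition ensures that the minimum in \<open>slength\<close>
    is attained.\<close>
  obtain D where D: "stanley_decomposition (*) multidegree_comp I D" "length D = ideal_slength I"
    using LeastI_ex[of "\<lambda>r. \<exists>D. stanley_decomposition (*) multidegree_comp I D \<and> length D = r"]
      stanley_decomposition_exists[OF assms] unfolding slength_def by blast
  have least: "ideal_slength I \<le> length D'" if "stanley_decomposition (*) multidegree_comp I D'" for D'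
    unfolding slength_def using that by (blast intro: Least_le)
  have "minimal_monomial_generating_set I (minimal_generators I)"
    unfolding minimal_generators_def by (rule theI'[OF ex1_minimal_monomial_generating_set[OF assms]])
  then have "card (minimal_generators I) \<le> ideal_slength I"
    using card_minimal_generating_set_le[OF assms _ D(1)] D(2) by simp
  moreover have "principal_ideal I \<longleftrightarrow> ideal_slength I = 1" if nz: "I \<noteq> {0}"
  proof
    assume "principal_ideal I"
    then obtain D' where "stanley_decomposition (*) multidegree_comp I D'" "length D' = 1"
      using principal_stanley_decomposition[OF assms _ nz] by blast
    then have "ideal_slength I \<le> 1" using least by metis
    moreover have "D \<noteq> []" using stanley_decomposition_length_0 D(1) nz by metis
    ultimately show "ideal_slength I = 1" using D(2) by (cases D) auto
  next
    assume "ideal_slength I = 1"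
    then obtain m Z where "D = [(m, Z)]" using D(2) by (cases D) auto
    then show "principal_ideal I" using stanley_decomposition_length_1[OF assms] D(1) by blast
  qed
  ultimately show ?thesis by blast
qed

end
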